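(* Let $n\ge 6$ and let $P$ be a convex $n$-gon in the plane with consecutive vertices $V_1,\dots,V_n$ (indices understood cyclically modulo $n$). Then $P$ has at least 6 extremal quintuples of vertices, i.e. there are at least 6 indices $i\in\mathbb{Z}/n$ for which the quintuple $(V_i,V_{i+1},V_{i+2},V_{i+3},V_{i+4})$ is extremal.
   Context: The plane is regarded as an affine part of the real projective plane $\mathbb{RP}^2$. As usual, the vertices of a convex $n$-gon are its $n$ distinct corners, so no three vertices are collinear; hence five vertices determine a unique conic, and the complement of this conic in $\mathbb{RP}^2$ has two connected components, called its sides. Five consecutive vertices $V_i,\dots,V_{i+4}$ are called extremal if $V_{i-1}$ and $V_{i+5}$ lie on the same side of the conic through these 5 points; this does not exclude the case when $V_{i-1}$ or $V_{i+5}$ belongs to the conic (so the quintuple counts as extremal whenever at least one of $V_{i-1},V_{i+5}$ lies on the conic, or both lie in the same component of its complement). For $n=6$ one has $V_{i-1}=V_{i+5}$. *)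

theory Defs
  imports "HOL-Analysis.Analysis"
begin

text \<open>The points of the real projective plane are the one-dimensional subspaces of
  \<open>real^3\<close>; the topology is the quotient topology under \<open>x \<mapsto> span {x}\<close>
  (see \<open>quotient_map_RP2\<close>).\<close>

definition RP2_points :: "(real^3) set set" where
  "RP2_points = {L. subspace L \<and> dim L = 1}"

definition RP2 :: "(real^3) set topology" where
  "RP2 = topology (\<lambda>U. U \<subseteq> RP2_points \<and> open {x. x \<noteq> 0 \<and> span {x} \<in> U})"

lemma RP2_points_eq: "RP2_points = (\<lambda>x. span {x}) ` (UNIV - {0})"
proof
  show "RP2_points \<subseteq> (\<lambda>x. span {x}) ` (UNIV - {0})"
  proof
    fix L assume "L \<in> RP2_points"
    then have L: "subspace L" "dim L = 1" by (auto simp: RP2_points_def)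
    obtain B where B: "B \<subseteq> L" "independent B" "L \<subseteq> span B" "card B = 1"
      using basis_exists[of L] L(2) by auto
    obtain x where x: "B = {x}" using B(4) card_1_singletonE by blast
    have "x \<noteq> 0" using B(2) x by auto
    moreover have "L = span {x}" using span_subspace[OF B(1,3) L(1)] x by simp
    ultimately show "L \<in> (\<lambda>x. span {x}) ` (UNIV - {0})" by blast
  qed
next
  show "(\<lambda>x. span {x}) ` (UNIV - {0}) \<subseteq> RP2_points"
    by (auto simp: RP2_points_def)
qed

lemma openin_RP2:
  "openin RP2 U \<longleftrightarrow> U \<subseteq> RP2_points \<and> open {x. x \<noteq> 0 \<and> span {x} \<in> U}"
proof -
  have "istopology (\<lambda>U. U \<subseteq> RP2_points \<and> open {x. x \<noteq> 0 \<and> span {x} \<in> U})"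
    unfolding istopology_def
  proof (intro conjI allI impI)
    fix S T :: "(real^3) set set"
    assume S: "S \<subseteq> RP2_points \<and> open {x. x \<noteq> 0 \<and> span {x} \<in> S}"
      and T: "T \<subseteq> RP2_points \<and> open {x. x \<noteq> 0 \<and> span {x} \<in> T}"
    show "S \<inter> T \<subseteq> RP2_points" using S by blast
    have "{x. x \<noteq> 0 \<and> span {x} \<in> S \<inter> T}
        = {x. x \<noteq> 0 \<and> span {x} \<in> S} \<inter> {x. x \<noteq> 0 \<and> span {x} \<in> T}" by blast
    then show "open {x. x \<noteq> 0 \<and> span {x} \<in> S \<inter> T}"
      using open_Int[OF conjunct2[OF S] conjunct2[OF T]] by (simp only:)
  next
    fix K :: "(real^3) set set set"
    assume K: "\<forall>S\<in>K. S \<subseteq> RP2_points \<and> open {x. x \<noteq> 0 \<and> span {x} \<in> S}"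
    show "\<Union>K \<subseteq> RP2_points" using K by blast
    have "{x. x \<noteq> 0 \<and> span {x} \<in> \<Union>K} = (\<Union>S\<in>K. {x. x \<noteq> 0 \<and> span {x} \<in> S})" by blast
    then show "open {x. x \<noteq> 0 \<and> span {x} \<in> \<Union>K}" using K by auto
  qed
  then show ?thesis by (simp add: RP2_def topology_inverse')
qed

lemma topspace_RP2: "topspace RP2 = RP2_points"
proof -
  have eq: "{x::real^3. x \<noteq> 0 \<and> span {x} \<in> RP2_points} = - {0}"
    by (auto simp: RP2_points_eq)
  have "openin RP2 RP2_points" unfolding openin_RP2 eq by (simp add: open_Compl)
  then show ?thesis
    using openin_RP2[of "topspace RP2"] openin_subset[of RP2 RP2_points] by auto
qed

lemma quotient_map_RP2:
  "quotient_map (top_of_set (UNIV - {0})) RP2 (\<lambda>x. span {x})"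
proof -
  have op: "open (UNIV - {0 :: real^3})" by (simp add: open_delete)
  have eq: "{x \<in> UNIV - {0}. span {x} \<in> U} = {x::real^3. x \<noteq> 0 \<and> span {x} \<in> U}" for U
    by blast
  have sub: "{x::real^3. x \<noteq> 0 \<and> span {x} \<in> U} \<subseteq> UNIV - {0}" for U by blast
  show ?thesis
    unfolding quotient_map_def topspace_RP2 topspace_euclidean_subtopology
      openin_RP2 RP2_points_eq eq openin_open_eq[OF op]
    using sub by auto
qed

text \<open>The affine plane is the chart \<open>(x, y) \<mapsto> [x : y : 1]\<close>.\<close>

definition proj_point :: "real^2 \<Rightarrow> (real^3) set" where
  "proj_point p = span {vector [p $ 1, p $ 2, 1]}"

definition projective_conic :: "(real^3) set set \<Rightarrow> bool" where
  "projective_conic C \<longleftrightarrow> (\<exists>A :: real^3^3. transpose A = A \<and> A \<noteq> 0 \<and>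
     C = {L \<in> topspace RP2. \<forall>x\<in>L. x \<bullet> (A *v x) = 0})"

text \<open>Well defined only when \<open>S\<close> determines the conic uniquely, as for five points
  no three of which are collinear.\<close>

definition conic_through :: "(real^3) set set \<Rightarrow> (real^3) set set" where
  "conic_through S = (THE C. projective_conic C \<and> S \<subseteq> C)"

definition sides :: "(real^3) set set \<Rightarrow> (real^3) set set set" where
  "sides C = connected_components_of (subtopology RP2 (topspace RP2 - C))"

text \<open>Indices modulo \<open>n\<close> are rendered by \<open>n\<close>-periodic families over the integers.
  Since all sides of \<open>P\<close> occur as segments between cyclic neighbours, the enumeration
  runs once around the boundary (in either direction).\<close>

definition convex_ngon :: "nat \<Rightarrow> (real^2) set \<Rightarrow> (int \<Rightarrow> real^2) \<Rightarrow> bool" where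
  "convex_ngon n P V \<longleftrightarrow>
     (\<forall>i. V (i + int n) = V i) \<and>
     inj_on V {1..int n} \<and>
     P = convex hull (range V) \<and>
     {p. p extreme_point_of P} = range V \<and>
     (\<forall>i. closed_segment (V i) (V (i + 1)) edge_of P)"

definition extremal :: "(int \<Rightarrow> real^2) \<Rightarrow> int \<Rightarrow> bool" where
  "extremal V i \<longleftrightarrow>
     (let C = conic_through ((\<lambda>j. proj_point (V j)) ` {i..i + 4});
          p = proj_point (V (i - 1)); q = proj_point (V (i + 5))
      in p \<in> C \<or> q \<in> C \<or> (\<exists>S\<in>sides C. p \<in> S \<and> q \<in> S))"

end

theory Submission
  imports Defs
begin

text \<open>Let \<open>D i\<close> be the determinant of the Veronese images of \<open>V i, \<dots>, V (i + 5)\<close>. The conic through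
  \<open>V i, \<dots>, V (i + 4)\<close> takes the values \<open>- D (i - 1)\<close> and \<open>D i\<close> at the two neighbouring vertices, and
  points at which a quadratic form has the same sign lie on the same side of its conic, so the
  quintuple is extremal if \<open>D (i - 1) * D i \<le> 0\<close>. Deleting a vertex replaces six consecutive
  entries of the cyclic sequence \<open>D\<close> by five positive combinations of neighbours, which follows from
  evaluating a pair of lines at the points concerned. This does not increase the number
  of sign changes, where zeros may be given signs so as to maximise it. For a hexagon
  \<open>D (i + 1) = - D i\<close>, which gives six sign changes, hence there are at least six for every \<open>n\<close>.\<close>

section \<open>Brackets and the six-point determinant\<close>

definition bracket :: "real^3 \<Rightarrow> real^3 \<Rightarrow> real^3 \<Rightarrow> real" where
  "bracket a b c = det (vector [a, b, c])"

lemma bracket_eq: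
  "bracket a b c = a$1 * (b$2 * c$3 - b$3 * c$2) - a$2 * (b$1 * c$3 - b$3 * c$1)
     + a$3 * (b$1 * c$2 - b$2 * c$1)"
  unfolding bracket_def by (simp add: det_3 algebra_simps)

lemma bracket_rotate: "bracket b c a = bracket a b c"
  unfolding bracket_eq by algebra

lemma bracket_swap: "bracket b a c = - bracket a b c"
  unfolding bracket_eq by algebra

lemma bracket_swap': "bracket a c b = - bracket a b c"
  unfolding bracket_eq by algebra

lemma bracket_eq_0 [simp]: "bracket a a b = 0" "bracket a b a = 0" "bracket b a a = 0"
  unfolding bracket_eq by algebra+

text \<open>The three-term Grassmann-Pluecker relation for four directions seen from
  \<open>z\<close>. It serves twice: for the antisymmetry of \<open>conic_det\<close> and for the
  angular order of the vertices seen from one of them.\<close>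

lemma bracket_Pluecker:
  "bracket z a b * bracket z c d - bracket z a c * bracket z b d
     + bracket z a d * bracket z b c = 0"
  unfolding bracket_eq by algebra

lemma bracket_linear: "bracket a b c = cross3 a b \<bullet> c"
  unfolding bracket_eq cross3_def inner_vec_def by (simp add: sum_3 algebra_simps)

text \<open>The determinant of the images of six points under the Veronese map, up to a constant factor,
  in brackets; as a function of \<open>f\<close> it is the member through \<open>a\<close> of the pencil of conics
  through \<open>b\<close>, \<open>c\<close>, \<open>d\<close>, \<open>e\<close>, spanned by two pairs of lines.\<close>

definition conic_det :: "real^3 \<Rightarrow> real^3 \<Rightarrow> real^3 \<Rightarrow> real^3 \<Rightarrow> real^3 \<Rightarrow> real^3 \<Rightarrow> real" where
  "conic_det a b c d e f =
     bracket b c a * bracket d e a * (bracket b d f * bracket c e f)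
     - bracket b d a * bracket c e a * (bracket b c f * bracket d e f)"

lemma conic_det_swap34: "conic_det a b d c e f = - conic_det a b c d e f"
  unfolding conic_det_def bracket_swap[of d c] bracket_swap'[of _ d c] bracket_swap[of d e] 
   bracket_swap[of e c] by (simp add: algebra_simps)

text \<open>The pencil of conics through \<open>b\<close>, \<open>c\<close>, \<open>d\<close>,
  \<open>e\<close> contains three pairs of lines; this is the linear relation between them. It gives
  the antisymmetry of \<open>conic_det\<close> in its inner arguments.\<close>

lemma bracket_Pluecker_last:
  "bracket c d x * bracket b e x = bracket b d x * bracket c e x - bracket b c x * bracket d e x"
  unfolding bracket_eq by algebra

lemma conic_det_swap23: "conic_det a c b d e f = - conic_det a b c d e f"
  unfolding conic_det_def bracket_Pluecker_last[of c d _ b e] bracket_swap[of c b] by algebra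

lemma conic_det_swap45: "conic_det a b c e d f = - conic_det a b c d e f"
proof -
  have *: "bracket b e x * bracket c d x = bracket b d x * bracket c e x - bracket b c x * bracket d e x" for x
    using bracket_Pluecker_last[of c d x b e] by (simp add: mult.commute)
  show ?thesis
  unfolding conic_det_def * bracket_swap[of e d] by algebra
qed

lemma conic_det_swap12: "conic_det b a c d e f = - conic_det a b c d e f"
proof -
  \<comment> \<open>The formula treats \<open>a\<close> and \<open>b\<close> differently. Pluecker
    relations seen from \<open>d\<close> and from \<open>c\<close> turn the two differences into
    products, after which both terms of the sum are equal and cancel.\<close>
  have 1: "bracket d e a * bracket b d f - bracket d e b * bracket a d f = bracket d e f * bracket a b d"
    using bracket_Pluecker[of d e a b f] bracket_swap[of d b f] bracket_swap[of d a f] bracket_rotate[of a b d]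
    by algebra
  have 2: "bracket c e a * bracket b c f - bracket c e b * bracket a c f = bracket c e f * bracket a b c"
    using bracket_Pluecker[of c e a b f] bracket_swap[of c b f] bracket_swap[of c a f] bracket_rotate[of a b c]
    by algebra
  have "conic_det b a c d e f + conic_det a b c d e f =
     bracket a b c * bracket c e f * (bracket d e a * bracket b d f - bracket d e b * bracket a d f)
    - bracket a b d * bracket d e f * (bracket c e a * bracket b c f - bracket c e b * bracket a c f)"
    unfolding conic_det_def bracket_rotate[of b _ a] bracket_rotate[of a _ b] bracket_swap[of b a]
    by algebra
  also have "\<dots> = 0" unfolding 1 2 by simp
  finally show ?thesis by simp
qed

lemma conic_det_rev: "conic_det f e d c b a = - conic_det a b c d e f"
  unfolding conic_det_def bracket_swap[of e d] bracket_swap[of c b] bracket_swap[of e c]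
    bracket_swap[of d b] by (simp add: algebra_simps)

lemma conic_det_swap56: "conic_det a b c d f e = - conic_det a b c d e f"
  by (simp add: conic_det_rev[of a b c d f e] conic_det_rev[of f e d c b a] conic_det_swap12[of e f])

text \<open>A cyclic shift of six points is an odd permutation, a product of five adjacent swaps.
  This sign makes the determinants of a hexagon alternate, and it relates the conic through a
  quintuple to the window that begins one vertex earlier.\<close>

lemma conic_det_rotate: "conic_det b c d e f a = - conic_det a b c d e f"
  by (simp add: conic_det_swap56[of b c d e f a] conic_det_swap45[of b c d e a f]
      conic_det_swap34[of b c d a e f] conic_det_swap23[of b c a d e f] conic_det_swap12[of b a])

text \<open>For fixed \<open>a\<close>, \<open>b\<close>, \<open>c\<close>, \<open>d\<close> the
  left-hand determinant is \<open>u x * v z - v x * u z\<close>, where \<open>u\<close> is the line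
  pair \<open>ab\<close>, \<open>cd\<close> and \<open>v\<close> the pair \<open>ac\<close>,
  \<open>bd\<close>. The identity is the linear dependence of the three plane vectors
  \<open>(u, v)\<close> at \<open>x\<close>, \<open>y\<close>, \<open>z\<close>.\<close>

lemma conic_det_three_term:
  "conic_det x a b c d z * (bracket a b y * bracket c d y)
     = conic_det y a b c d z * (bracket a b x * bracket c d x)
     + conic_det x a b c d y * (bracket a b z * bracket c d z)"
  unfolding conic_det_def by (simp add: algebra_simps)

text \<open>Deleting one of the inner points of seven: after the three-term relation all brackets are
  written with increasing indices, so that they have the same sign for a convex polygon.\<close>

lemma conic_det_omit1:
  "conic_det w0 w2 w3 w4 w5 w6 * (bracket w1 w2 w3 * bracket w1 w4 w5)
     = conic_det w1 w2 w3 w4 w5 w6 * (bracket w0 w2 w3 * bracket w0 w4 w5)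
     + conic_det w0 w1 w2 w3 w4 w5 * (bracket w2 w3 w6 * bracket w4 w5 w6)"
  using conic_det_three_term[of w0 w2 w3 w4 w5 w6 w1]
  unfolding conic_det_swap56[of w0 w2 w3 w4 w5 w1]
    conic_det_swap45[of w0 w2 w3 w4 w1 w5]
    conic_det_swap34[of w0 w2 w3 w1 w4 w5]
    conic_det_swap23[of w0 w2 w1 w3 w4 w5]
    bracket_rotate[of w2 w3 w1]
    bracket_rotate[of w4 w5 w1]
    bracket_rotate[of w2 w3 w0]
    bracket_rotate[of w4 w5 w0]
  by (simp only: minus_minus mult_minus_left mult_minus_right minus_add_distrib[symmetric] neg_equal_iff_equal)

lemma conic_det_omit2:
  "conic_det w0 w1 w3 w4 w5 w6 * (bracket w1 w2 w3 * bracket w2 w4 w5)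
     = conic_det w1 w2 w3 w4 w5 w6 * (bracket w0 w1 w3 * bracket w0 w4 w5)
     + conic_det w0 w1 w2 w3 w4 w5 * (bracket w1 w3 w6 * bracket w4 w5 w6)"
  using conic_det_three_term[of w0 w1 w3 w4 w5 w6 w2]
  unfolding conic_det_swap12[of w2 w1 w3 w4 w5 w6]
    conic_det_swap56[of w0 w1 w3 w4 w5 w2]
    conic_det_swap45[of w0 w1 w3 w4 w2 w5]
    conic_det_swap34[of w0 w1 w3 w2 w4 w5]
    bracket_swap'[of w1 w3 w2]
    bracket_rotate[of w4 w5 w2]
    bracket_rotate[of w1 w3 w0]
    bracket_rotate[of w4 w5 w0]
  by (simp only: minus_minus mult_minus_left mult_minus_right minus_add_distrib[symmetric] neg_equal_iff_equal)

lemma conic_det_omit3: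
  "conic_det w0 w1 w2 w4 w5 w6 * (bracket w1 w2 w3 * bracket w3 w4 w5)
     = conic_det w1 w2 w3 w4 w5 w6 * (bracket w0 w1 w2 * bracket w0 w4 w5)
     + conic_det w0 w1 w2 w3 w4 w5 * (bracket w1 w2 w6 * bracket w4 w5 w6)"
  using conic_det_three_term[of w0 w1 w2 w4 w5 w6 w3]
  unfolding conic_det_swap12[of w3 w1 w2 w4 w5 w6]
    conic_det_swap23[of w1 w3 w2 w4 w5 w6]
    conic_det_swap56[of w0 w1 w2 w4 w5 w3]
    conic_det_swap45[of w0 w1 w2 w4 w3 w5]
    bracket_rotate[of w4 w5 w3]
    bracket_rotate[of w1 w2 w0]
    bracket_rotate[of w4 w5 w0]
  by (simp only: minus_minus mult_minus_left mult_minus_right minus_add_distrib[symmetric] neg_equal_iff_equal)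

lemma conic_det_omit4:
  "conic_det w0 w1 w2 w3 w5 w6 * (bracket w1 w2 w4 * bracket w3 w4 w5)
     = conic_det w1 w2 w3 w4 w5 w6 * (bracket w0 w1 w2 * bracket w0 w3 w5)
     + conic_det w0 w1 w2 w3 w4 w5 * (bracket w1 w2 w6 * bracket w3 w5 w6)"
  using conic_det_three_term[of w0 w1 w2 w3 w5 w6 w4]
  unfolding conic_det_swap12[of w4 w1 w2 w3 w5 w6]
    conic_det_swap23[of w1 w4 w2 w3 w5 w6]
    conic_det_swap34[of w1 w2 w4 w3 w5 w6]
    conic_det_swap56[of w0 w1 w2 w3 w5 w4]
    bracket_swap'[of w3 w5 w4]
    bracket_rotate[of w1 w2 w0]
    bracket_rotate[of w3 w5 w0]
  by (simp only: minus_minus mult_minus_left mult_minus_right minus_add_distrib[symmetric] neg_equal_iff_equal)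

lemma conic_det_omit5:
  "conic_det w0 w1 w2 w3 w4 w6 * (bracket w1 w2 w5 * bracket w3 w4 w5)
     = conic_det w1 w2 w3 w4 w5 w6 * (bracket w0 w1 w2 * bracket w0 w3 w4)
     + conic_det w0 w1 w2 w3 w4 w5 * (bracket w1 w2 w6 * bracket w3 w4 w6)"
  using conic_det_three_term[of w0 w1 w2 w3 w4 w6 w5]
  unfolding conic_det_swap12[of w5 w1 w2 w3 w4 w6]
    conic_det_swap23[of w1 w5 w2 w3 w4 w6]
    conic_det_swap34[of w1 w2 w5 w3 w4 w6]
    conic_det_swap45[of w1 w2 w3 w5 w4 w6]
    bracket_rotate[of w1 w2 w0]
    bracket_rotate[of w3 w4 w0]
  by (simp only: minus_minus mult_minus_left mult_minus_right minus_add_distrib[symmetric] neg_equal_iff_equal)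

section \<open>Sign changes under deletion of a vertex\<close>

text \<open>The factor \<open>\<sigma>\<close> accounts for the two orientations.\<close>

definition convex_position :: "real \<Rightarrow> nat \<Rightarrow> (nat \<Rightarrow> real^3) \<Rightarrow> bool" where
  "convex_position \<sigma> n h \<longleftrightarrow> (\<forall>m. h (m + n) = h m) \<and>
     (\<forall>i j k. i < j \<and> j < k \<and> k < i + n \<longrightarrow> 0 < \<sigma> * bracket (h i) (h j) (h k))"

definition window_det :: "(nat \<Rightarrow> real^3) \<Rightarrow> nat \<Rightarrow> real" where
  "window_det h m = conic_det (h m) (h (m+1)) (h (m+2)) (h (m+3)) (h (m+4)) (h (m+5))"

section \<open>Total variation of periodic sequences\<close>

lemma sum_abs_diff_shift:
  fixes d :: "nat \<Rightarrow> real"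
  assumes "\<And>m. d (m + n) = d m"
  shows "(\<Sum>k\<in>{c..<c+n}. \<bar>d (k+1) - d k\<bar>) = (\<Sum>k<n. \<bar>d (k+1) - d k\<bar>)"
proof (induction c)
  case 0
  show ?case by (simp add: atLeast0LessThan)
next
  case (Suc c)
  let ?f = "\<lambda>k. \<bar>d (k+1) - d k\<bar>"
  have "sum ?f {Suc c..<Suc (c+n)} + ?f c = sum ?f {c..<Suc (c+n)}"
    using sum.atLeast_Suc_lessThan[of c "Suc (c+n)" ?f] by linarith
  also have "\<dots> = sum ?f {c..<c+n} + ?f (c+n)" by simp
  also have "?f (c+n) = ?f c" using assms[of c] assms[of "c+1"] by (simp add: add.commute add.left_commute)
  finally show ?case using Suc.IH by simp
qed

lemma sum_abs_diff_subsequence: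
  fixes d :: "nat \<Rightarrow> real" and c :: "nat \<Rightarrow> nat"
  assumes "\<And>i. i < N \<Longrightarrow> c i \<le> c (i+1)"
  shows "(\<Sum>i<N. \<bar>d (c (i+1)) - d (c i)\<bar>) \<le> (\<Sum>k\<in>{c 0..<c N}. \<bar>d (k+1) - d k\<bar>) \<and> c 0 \<le> c N"
  using assms
proof (induction N)
  case 0
  show ?case by simp
next
  case (Suc N)
  let ?f = "\<lambda>k. \<bar>d (k+1) - d k\<bar>"
  have 1: "(\<Sum>i<N. \<bar>d (c (i+1)) - d (c i)\<bar>) \<le> sum ?f {c 0..<c N}" "c 0 \<le> c N"
    using Suc by auto
  have 2: "c N \<le> c (N+1)" using Suc.prems by simp
  have "d (c (N+1)) - d (c N) = (\<Sum>k\<in>{c N..<c (N+1)}. d (k+1) - d k)"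
    using sum_Suc_diff'[OF 2, of d] by simp
  then have "\<bar>d (c (N+1)) - d (c N)\<bar> \<le> sum ?f {c N..<c (N+1)}" by (simp only: sum_abs)
  moreover have "sum ?f {c 0..<c (N+1)} = sum ?f {c 0..<c N} + sum ?f {c N..<c (N+1)}"
    using 1 2 by (simp only: sum.atLeastLessThan_concat)
  ultimately show ?case using 1 2 by simp
qed

text \<open>For values \<open>1\<close> and \<open>-1\<close> these sums are twice the number of
  cyclic sign changes. One turn of \<open>d'\<close> reads \<open>d\<close> along a nondecreasing
  sequence of indices spanning one period, so its variation cannot be larger.\<close>

lemma sum_abs_diff_delete_one:
  fixes d d' :: "nat \<Rightarrow> real"
  assumes d: "\<And>m. d (m + Suc N) = d m" and d': "d' N = d' 0" and N: "0 < N"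
    and choice: "\<And>i. i < N \<Longrightarrow> d' i = d i \<or> d' i = d (i+1)"
  shows "(\<Sum>i<N. \<bar>d' (i+1) - d' i\<bar>) \<le> (\<Sum>k<Suc N. \<bar>d (k+1) - d k\<bar>)"
proof -
  define b where "b i = (if d' i = d i then i else i + 1)" for i
  \<comment> \<open>The last index is set to \<open>b 0 + Suc N\<close>, so that the walk closes
    after exactly one period of \<open>d\<close>, wherever it started.\<close>
  define c where "c i = (if i < N then b i else b 0 + Suc N)" for i
  have dc: "d' i = d (c i)" if "i \<le> N" for i
    using that choice[of i] choice[of 0] d[of "b 0"] d' N by (cases "i < N") (auto simp: c_def b_def)
  have mono: "c i \<le> c (i+1)" if "i < N" for i
    using that by (auto simp: c_def b_def)
  have "(\<Sum>i<N. \<bar>d' (i+1) - d' i\<bar>) = (\<Sum>i<N. \<bar>d (c (i+1)) - d (c i)\<bar>)"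
    by (intro sum.cong refl) (auto simp: dc)
  also have "\<dots> \<le> (\<Sum>k\<in>{c 0..<c N}. \<bar>d (k+1) - d k\<bar>)"
    using sum_abs_diff_subsequence[of N c d] mono by blast
  also have "c N = c 0 + Suc N" using N by (simp add: c_def)
  also have "(\<Sum>k\<in>{c 0..<c 0 + Suc N}. \<bar>d (k+1) - d k\<bar>) = (\<Sum>k<Suc N. \<bar>d (k+1) - d k\<bar>)"
    by (rule sum_abs_diff_shift, rule d)
  finally show ?thesis .
qed

section \<open>Deletion of one vertex in every period\<close>

lemma skip_add:
  fixes N m t :: nat
  assumes "t \<le> N" "m < N"
  shows "(m + t) + (m + t) div N = (if m + t < N then m + t else m + t + 1)"
proof (cases "m + t < N")
  case False
  then have "(m + t) div N = 1" using assms by (intro div_nat_eqI) auto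
  then show ?thesis using False by simp
qed simp

text \<open>The map sending \<open>m\<close> to \<open>m + m div N\<close> is strictly increasing
  and skips exactly the indices congruent to \<open>N\<close> modulo \<open>Suc N\<close>. An
  increase of \<open>m\<close> by \<open>N\<close> raises its value by \<open>Suc N\<close>, so
  index triples within one period stay within one period.\<close>

lemma convex_position_delete:
  assumes "convex_position \<sigma> (Suc N) h" "0 < N"
  shows "convex_position \<sigma> N (\<lambda>m. h (m + m div N))"
  unfolding convex_position_def
proof (intro conjI allI impI)
  fix m
  show "h (m + N + (m + N) div N) = h (m + m div N)"
    using assms unfolding convex_position_def
    by (metis add.assoc add.commute div_add_self2 less_not_refl plus_1_eq_Suc)
next
  fix i j k assume "i < j \<and> j < k \<and> k < i + N"
  moreover from this have "i div N \<le> j div N" "j div N \<le> k div N" "k div N \<le> (i + N) div N"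
    by (simp_all only: div_le_mono order_less_imp_le)
  moreover have "(i + N) div N = i div N + 1" using assms by simp
  ultimately show "0 < \<sigma> * bracket (h (i + i div N)) (h (j + j div N)) (h (k + k div N))"
    using assms unfolding convex_position_def by simp
qed

lemma convex_position_bracket:
  assumes "convex_position \<sigma> n h" "i < j" "j < k" "k < i + n"
  shows "0 < \<sigma> * bracket (h i) (h j) (h k)"
  using assms by (auto simp: convex_position_def)

lemma mult_pos_of_scaled:
  fixes s a b :: real
  assumes "0 < s * a" "0 < s * b"
  shows "0 < a * b"
  using assms by (auto simp: zero_less_mult_iff)

lemma positive_combination:
  fixes q0 q1 q2 D0 D1 E :: real
  assumes "E * q1 = D1 * q0 + D0 * q2" "0 < q0" "0 < q1" "0 < q2"
  shows "\<exists>\<alpha>>0. \<exists>\<beta>\<ge>0. E = \<alpha> * D0 + \<beta> * D1"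
proof (intro exI conjI)
  show "E = (q2/q1) * D0 + (q0/q1) * D1" using assms by (simp add: field_simps)
qed (use assms in auto)

text \<open>The new window consists of six of the seven vertices from \<open>h i\<close> to
  \<open>h (i + 6)\<close>, and an omission identity applies. The coefficient \<open>\<beta>\<close>
  may be zero because a window that ends before the deleted vertex is unchanged.\<close>

lemma window_det_delete:
  assumes cp: "convex_position \<sigma> (Suc N) h" and N: "6 \<le> N" and i: "i < N"
  shows "\<exists>\<alpha>>0. \<exists>\<beta>\<ge>0. window_det (\<lambda>m. h (m + m div N)) i
            = \<alpha> * window_det h i + \<beta> * window_det h (i+1)"
proof -
  let ?w = "\<lambda>t. h (i + t)"
  \<comment> \<open>Since \<open>6 \<le> N\<close>, the seven vertices lie within one period, and
    the sign of \<open>\<sigma>\<close> cancels in a product of two brackets.\<close>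
  have pos: "0 < bracket (?w a) (?w b) (?w c) * bracket (?w a') (?w b') (?w c')"
    if "a < b" "b < c" "c < 7" "a' < b'" "b' < c'" "c' < 7" for a b c a' b' c'
    using that N by - (rule mult_pos_of_scaled[of \<sigma>]; rule convex_position_bracket[OF cp]; simp)
  define g where "g t = h ((i + t) + (i + t) div N)" for t
  have g: "g t = ?w (if i + t < N then t else t + 1)" if "t \<le> 5" for t
    using skip_add[of t N i] that i N unfolding g_def by (simp add: add.assoc)
  have "window_det (\<lambda>m. h (m + m div N)) i = conic_det (g 0) (g 1) (g 2) (g 3) (g 4) (g 5)"
    unfolding g_def window_det_def add_0_right ..
  also have "\<dots> = conic_det (?w 0)
     (?w (if i + 1 < N then 1 else 2)) (?w (if i + 2 < N then 2 else 3)) (?w (if i + 3 < N then 3 else 4))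
     (?w (if i + 4 < N then 4 else 5)) (?w (if i + 5 < N then 5 else 6))"
    using i g[of 0] g[of 1] g[of 2] g[of 3] g[of 4] g[of 5] by simp
  finally have *: "window_det (\<lambda>m. h (m + m div N)) i = \<dots>" .
  let ?D0 = "conic_det (?w 0) (?w 1) (?w 2) (?w 3) (?w 4) (?w 5)"
  let ?D1 = "conic_det (?w 1) (?w 2) (?w 3) (?w 4) (?w 5) (?w 6)"
  have D01: "window_det h i = ?D0" "window_det h (i+1) = ?D1"
    by (simp_all add: window_det_def numeral_eq_Suc)
  let ?goal = "\<lambda>E. \<exists>\<alpha>>0. \<exists>\<beta>\<ge>0. E = \<alpha> * ?D0 + \<beta> * ?D1"
  have omit1: "?goal (conic_det (?w 0) (?w 2) (?w 3) (?w 4) (?w 5) (?w 6))"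
    by (rule positive_combination[OF conic_det_omit1]; rule pos; simp)
  have omit2: "?goal (conic_det (?w 0) (?w 1) (?w 3) (?w 4) (?w 5) (?w 6))"
    by (rule positive_combination[OF conic_det_omit2]; rule pos; simp)
  have omit3: "?goal (conic_det (?w 0) (?w 1) (?w 2) (?w 4) (?w 5) (?w 6))"
    by (rule positive_combination[OF conic_det_omit3]; rule pos; simp)
  have omit4: "?goal (conic_det (?w 0) (?w 1) (?w 2) (?w 3) (?w 5) (?w 6))"
    by (rule positive_combination[OF conic_det_omit4]; rule pos; simp)
  have omit5: "?goal (conic_det (?w 0) (?w 1) (?w 2) (?w 3) (?w 4) (?w 6))"
    by (rule positive_combination[OF conic_det_omit5]; rule pos; simp)
  have omit6: "?goal ?D0"
    by (intro exI[of _ 1] exI[of _ 0] conjI) auto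
  \<comment> \<open>If \<open>i + t = N\<close>, the deleted vertex is the one at position
    \<open>t\<close> of the seven.\<close>
  consider "i + 5 < N" | "i + 5 = N" | "i + 4 = N" | "i + 3 = N" | "i + 2 = N" | "i + 1 = N"
    using i by linarith
  then have "?goal (window_det (\<lambda>m. h (m + m div N)) i)"
  proof cases
    case 1 then show ?thesis using omit6 unfolding * by simp
  next
    case 2 then show ?thesis using omit5 unfolding * by simp
  next
    case 3 then show ?thesis using omit4 unfolding * by simp
  next
    case 4 then show ?thesis using omit3 unfolding * by simp
  next
    case 5 then show ?thesis using omit2 unfolding * by simp
  next
    case 6 then show ?thesis using omit1 unfolding * by simp
  qed
  then show ?thesis unfolding D01 .
qed

lemma window_det_periodic:
  assumes "\<And>m. h (m + n) = h m"
  shows "window_det h (m + n) = window_det h m"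
proof -
  have "h (m + n + t) = h (m + t)" for t
    using assms[of "m + t"] by (simp add: add.assoc add.commute[of n])
  moreover have "h (m + n) = h m" by (rule assms)
  ultimately show ?thesis by (simp only: window_det_def)
qed

section \<open>Sign sequences, by induction from the hexagon\<close>

lemma window_det_alternates:
  assumes h: "\<And>m. h (m + 6) = h m"
  shows "window_det h m = (-1)^m * window_det h 0"
proof (induction m)
  case (Suc m)
  have "window_det h (m + 1) = conic_det (h (m+1)) (h (m+2)) (h (m+3)) (h (m+4)) (h (m+5)) (h (m+6))"
    by (simp add: window_det_def numeral_eq_Suc)
  also have "\<dots> = - window_det h m"
    unfolding h window_det_def by (rule conic_det_rotate)
  finally show ?case using Suc by simp
qed simp

lemma exists_sign_sequence:
  assumes "6 \<le> n" "convex_position \<sigma> n h"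
  shows "\<exists>d::nat \<Rightarrow> real. (\<forall>m. d m = 1 \<or> d m = -1) \<and> (\<forall>m. d (m + n) = d m) \<and>
    (\<forall>m. 0 \<le> d m * window_det h m) \<and> 12 \<le> (\<Sum>m<n. \<bar>d (m+1) - d m\<bar>)"
  using assms
proof (induction n arbitrary: h rule: nat_induct_at_least)
  case base
  then have h: "h (m + 6) = h m" for m by (simp add: convex_position_def)
  \<comment> \<open>If the determinant at \<open>0\<close> vanishes, they all do, and any
    alternating signs are admissible.\<close>
  define s :: real where "s = (if 0 \<le> window_det h 0 then 1 else -1)"
  define d :: "nat \<Rightarrow> real" where "d m = s * (-1)^m" for m
  have "d m = 1 \<or> d m = -1" for m
    by (cases "even m") (auto simp: d_def s_def)
  moreover have "d (m + 6) = d m" for m by (simp add: d_def power_add)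
  moreover have "0 \<le> d m * window_det h m" for m
    unfolding window_det_alternates[of h m, OF h] d_def
    by (cases "even m") (auto simp: s_def)
  moreover have "\<bar>d (m+1) - d m\<bar> = 2" for m
    by (cases "even m") (auto simp: d_def s_def)
  ultimately show ?case by (intro exI[of _ d]) simp
next
  case (Suc N)
  let ?h' = "\<lambda>m. h (m + m div N)" and ?W = "window_det h"
  have N: "6 \<le> N" by fact
  have h: "h (m + Suc N) = h m" for m
    using Suc.prems by (simp add: convex_position_def)
  obtain d' :: "nat \<Rightarrow> real" where d': "\<And>m. d' m = 1 \<or> d' m = -1" "\<And>m. d' (m + N) = d' m"
    "\<And>m. 0 \<le> d' m * window_det ?h' m" "12 \<le> (\<Sum>m<N. \<bar>d' (m+1) - d' m\<bar>)"
    using Suc.IH[OF convex_position_delete[OF Suc.prems]] N by auto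
  \<comment> \<open>Where the window determinant vanishes, the sign is inherited from the smaller polygon:
    this keeps the number of sign changes up even if many consecutive vertices lie on a conic.\<close>
  define d where "d m = (if 0 < ?W m then 1 else if ?W m < 0 then -1
      else if m mod Suc N < N then d' (m mod Suc N) else 1)" for m
  have dW: "0 \<le> d m * ?W m" for m by (simp add: d_def)
  have d1: "d m = 1 \<or> d m = -1" for m using d'(1) by (simp add: d_def)
  have dN: "d (m + Suc N) = d m" for m
    unfolding d_def window_det_periodic[of h "Suc N", OF h] mod_add_self2 by (rule refl)
  have "d' i = d i \<or> d' i = d (i+1)" if i: "i < N" for i
  proof (cases "?W i = 0")
    case True
    then show ?thesis using i by (simp add: d_def)
  next
    case False
    obtain \<alpha> \<beta> where ab: "0 < \<alpha>" "0 \<le> \<beta>" "window_det ?h' i = \<alpha> * ?W i + \<beta> * ?W (i+1)"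
      using window_det_delete[OF Suc.prems N i] by blast
    show ?thesis
    \<comment> \<open>If both neighbouring signs differed from \<open>d' i\<close>, the combination
      would be strictly of the sign opposite to \<open>d' i\<close>; strictness comes from
      \<open>\<alpha> > 0\<close> and \<open>?W i \<noteq> 0\<close>.\<close>
    proof (rule ccontr)
      assume "\<not> ?thesis"
      then have opp: "d i = - d' i" "d (i+1) = - d' i"
        using d1[of i] d1[of "i+1"] d'(1)[of i] by auto
      then have "d' i * ?W i < 0" "d' i * ?W (i+1) \<le> 0"
        using False dW[of i] dW[of "i+1"] d'(1)[of i] by auto
      then have "\<alpha> * (d' i * ?W i) < 0" "\<beta> * (d' i * ?W (i+1)) \<le> 0"
        using ab by (auto simp: mult_pos_neg mult_nonneg_nonpos)
      then have "d' i * window_det ?h' i < 0" unfolding ab(3) by (simp add: algebra_simps)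
      then show False using d'(3)[of i] by simp
    qed
  qed
  moreover have "d' N = d' 0" "0 < N" using d'(2)[of 0] N by simp_all
  ultimately have "(\<Sum>m<N. \<bar>d' (m+1) - d' m\<bar>) \<le> (\<Sum>m<Suc N. \<bar>d (m+1) - d m\<bar>)"
    using sum_abs_diff_delete_one[of d N d', OF dN] by blast
  then have "12 \<le> (\<Sum>m<Suc N. \<bar>d (m+1) - d m\<bar>)" using d'(4) by (rule order_trans[rotated])
  then show ?case by (intro exI[of _ d] conjI allI d1 dN dW)
qed

lemma card_nonpos_products_ge_6:
  assumes "6 \<le> n" "convex_position \<sigma> n h"
  shows "6 \<le> card {m. m < n \<and> window_det h m * window_det h (m+1) \<le> 0}" (is "_ \<le> card ?S")
proof -
  obtain d :: "nat \<Rightarrow> real" where d: "\<And>m. d m = 1 \<or> d m = -1"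
    "\<And>m. 0 \<le> d m * window_det h m" "12 \<le> (\<Sum>m<n. \<bar>d (m+1) - d m\<bar>)"
    using exists_sign_sequence[OF assms] by blast
  \<comment> \<open>If two consecutive determinants have a positive product, their admissible signs
    agree; otherwise the jump is at most \<open>2\<close>.\<close>
  have "\<bar>d (m+1) - d m\<bar> \<le> (if m \<in> ?S then 2 else 0)" if "m < n" for m
    using that d(1)[of m] d(1)[of "m+1"] d(2)[of m] d(2)[of "m+1"]
    by (auto simp: mult_le_0_iff)
  then have "(\<Sum>m<n. \<bar>d (m+1) - d m\<bar>) \<le> (\<Sum>m<n. if m \<in> ?S then 2 else 0)"
    by (intro sum_mono) auto
  also have "\<dots> = 2 * real (card ?S)"
    by (simp add: sum.If_cases Collect_conj_eq lessThan_def[symmetric] Int_assoc[symmetric])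
  finally show ?thesis using d(3) by linarith
qed

section \<open>Conics and their sides\<close>

lemma inner_symmetric_matrix:
  fixes M :: "real^3^3"
  assumes "transpose M = M"
  shows "x \<bullet> (M *v y) = y \<bullet> (M *v x)"
  by (metis assms dot_lmul_matrix inner_commute transpose_matrix_vector)

lemma quadratic_form_combination:
  fixes M :: "real^3^3"
  assumes "transpose M = M"
  shows "(X *\<^sub>R a + Y *\<^sub>R b + Z *\<^sub>R c) \<bullet> (M *v (X *\<^sub>R a + Y *\<^sub>R b + Z *\<^sub>R c))
    = X\<^sup>2 * (a \<bullet> (M *v a)) + Y\<^sup>2 * (b \<bullet> (M *v b)) + Z\<^sup>2 * (c \<bullet> (M *v c))
      + 2 * (X * Y * (a \<bullet> (M *v b)) + Y * Z * (b \<bullet> (M *v c)) + X * Z * (a \<bullet> (M *v c)))"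
  using inner_symmetric_matrix[OF assms, of b a] inner_symmetric_matrix[OF assms, of c b]
    inner_symmetric_matrix[OF assms, of c a]
  by (simp add: matrix_vector_right_distrib matrix_vector_mult_scaleR inner_add_left inner_add_right
      power2_eq_square algebra_simps)

lemma quadratic_form_scaleR:
  fixes M :: "real^3^3"
  shows "(k *\<^sub>R x) \<bullet> (M *v (k *\<^sub>R x)) = k\<^sup>2 * (x \<bullet> (M *v x))"
  by (simp add: matrix_vector_mult_scaleR power2_eq_square)

lemma symmetric_matrix_eq_0:
  fixes M :: "real^3^3"
  assumes "transpose M = M" "\<And>x. x \<bullet> (M *v x) = 0"
  shows "M = 0"
proof -
  have "x \<bullet> (M *v y) = 0" for x y
    using quadratic_form_combination[OF assms(1), of 1 x 1 y 0 0] assms(2) by simp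
  then have "M *v y = 0" for y using inner_eq_zero_iff by blast
  then show ?thesis by (metis matrix_eq matrix_vector_mult_0)
qed

lemma conic_det_matrix:
  obtains M :: "real^3^3" where "transpose M = M" "\<And>x. x \<bullet> (M *v x) = conic_det a b c d e x"
proof
  \<comment> \<open>The symmetrised outer product: its quadratic form is the product of the linear
    forms given by \<open>u\<close> and \<open>v\<close>, here a pair of lines.\<close>
  let ?M = "\<lambda>u v. (\<chi> i j. (u $ i * v $ j + v $ i * u $ j) / 2) :: real^3^3"
  have q: "x \<bullet> (?M u v *v x) = (u \<bullet> x) * (v \<bullet> x)" for u v x :: "real^3"
    by (simp add: inner_vec_def matrix_vector_mult_def sum_3 field_simps)
  let ?k = "bracket b c a * bracket d e a" and ?l = "bracket b d a * bracket c e a"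
  let ?A = "?k *\<^sub>R ?M (cross3 b d) (cross3 c e) - ?l *\<^sub>R ?M (cross3 b c) (cross3 d e)"
  show "transpose ?A = ?A" by (simp add: transpose_def vec_eq_iff mult.commute add.commute)
  show "x \<bullet> (?A *v x) = conic_det a b c d e x" for x
    by (simp add: conic_det_def bracket_linear[of _ _ x] matrix_vector_mult_diff_rdistrib
        scaleR_matrix_vector_assoc[symmetric] inner_diff_right q)
qed

text \<open>In coordinates with respect to the basis \<open>a\<close>, \<open>b\<close>,
  \<open>c\<close>, a form vanishing at these points has only its three mixed coefficients.
  Vanishing at \<open>d\<close> and \<open>e\<close> imposes two independent linear conditions on
  them, which leaves a line of solutions.\<close>

lemma conic_form_unique:
  assumes nz: "bracket a b c \<noteq> 0" "bracket a d c \<noteq> 0" "bracket a e c \<noteq> 0" "bracket b d e \<noteq> 0"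
  obtains G :: "real^3 \<Rightarrow> real" where
    "\<And>M::real^3^3. transpose M = M \<Longrightarrow> (\<And>x. x \<in> {a, b, c, d, e} \<Longrightarrow> x \<bullet> (M *v x) = 0)
       \<Longrightarrow> \<exists>k. \<forall>x. x \<bullet> (M *v x) = k * G x"
proof -
  let ?X = "\<lambda>x. bracket x b c" and ?Y = "\<lambda>x. bracket a x c" and ?Z = "\<lambda>x. bracket a b x"
  \<comment> \<open>The cross product of the two coefficient rows, in the order \<open>?P\<close>,
    \<open>?R\<close>, \<open>?S\<close>; \<open>m3 \<noteq> 0\<close> shows that the rows are
    independent.\<close>
  define m1 where "m1 = ?Y d * ?Z d * (?X e * ?Z e) - ?X d * ?Z d * (?Y e * ?Z e)"
  define m2 where "m2 = ?X d * ?Z d * (?X e * ?Y e) - ?X d * ?Y d * (?X e * ?Z e)"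
  define m3 where "m3 = ?X d * ?Y d * (?Y e * ?Z e) - ?Y d * ?Z d * (?X e * ?Y e)"
  have "?X d * ?Z e - ?Z d * ?X e = - (bracket a b c * bracket b d e)"
    unfolding bracket_eq by algebra
  moreover have "m3 = ?Y d * ?Y e * (?X d * ?Z e - ?Z d * ?X e)" unfolding m3_def by algebra
  ultimately have m3: "m3 \<noteq> 0" using nz by simp
  show thesis
  proof (rule that)
    fix M :: "real^3^3"
    assume M: "transpose M = M" and "\<And>x. x \<in> {a, b, c, d, e} \<Longrightarrow> x \<bullet> (M *v x) = 0"
    then have z: "a \<bullet> (M *v a) = 0" "b \<bullet> (M *v b) = 0" "c \<bullet> (M *v c) = 0" "d \<bullet> (M *v d) = 0"
      "e \<bullet> (M *v e) = 0" by auto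
    let ?P = "a \<bullet> (M *v b)" and ?R = "b \<bullet> (M *v c)" and ?S = "a \<bullet> (M *v c)"
    have cramer: "bracket a b c *\<^sub>R x = ?X x *\<^sub>R a + ?Y x *\<^sub>R b + ?Z x *\<^sub>R c" for x
      unfolding vec_eq_iff forall_3 by (simp add: bracket_eq algebra_simps)
    have q: "(bracket a b c)\<^sup>2 * (x \<bullet> (M *v x)) =
      2 * (?X x * ?Y x * ?P + ?Y x * ?Z x * ?R + ?X x * ?Z x * ?S)" for x
      unfolding quadratic_form_scaleR[symmetric] cramer[of x] quadratic_form_combination[OF M] z
      by simp
    have "?X d * ?Y d * ?P + ?Y d * ?Z d * ?R + ?X d * ?Z d * ?S = 0"
      "?X e * ?Y e * ?P + ?Y e * ?Z e * ?R + ?X e * ?Z e * ?S = 0"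
      using q[of d] q[of e] z by simp_all
    then have m: "?P * m3 = ?S * m1" "?R * m3 = ?S * m2"
      unfolding m1_def m2_def m3_def by algebra+
    define t where "t = ?S / m3"
    have S: "?S = t * m3" using m3 by (simp add: t_def)
    have "?P * m3 = (t * m1) * m3" "?R * m3 = (t * m2) * m3"
      unfolding m S by (simp_all only: mult.assoc mult.commute[of m3])
    then have PR: "?P = t * m1" "?R = t * m2" "?S = t * m3"
      using m3 S by simp_all
    have "x \<bullet> (M *v x) = 2 * t / (bracket a b c)\<^sup>2 *
        (?X x * ?Y x * m1 + ?Y x * ?Z x * m2 + ?X x * ?Z x * m3)" for x
    proof -
      have "(bracket a b c)\<^sup>2 * (x \<bullet> (M *v x)) = 2 * t *
        (?X x * ?Y x * m1 + ?Y x * ?Z x * m2 + ?X x * ?Z x * m3)"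
        unfolding q using PR by algebra
      then show ?thesis using nz(1) by (simp add: field_simps)
    qed
    then show "\<exists>k. \<forall>x. x \<bullet> (M *v x) = k * (?X x * ?Y x * m1 + ?Y x * ?Z x * m2 + ?X x * ?Z x * m3)"
      by blast
  qed
qed

section \<open>The conic through five points\<close>

definition conic_of :: "(real^3 \<Rightarrow> real) \<Rightarrow> (real^3) set set" where
  "conic_of f = {L \<in> topspace RP2. \<forall>x\<in>L. f x = 0}"

lemma span_in_conic_of:
  assumes "\<And>k x. f (k *\<^sub>R x) = k\<^sup>2 * f x" "p \<noteq> 0"
  shows "span {p} \<in> conic_of f \<longleftrightarrow> f p = 0"
proof -
  have "span {p} \<in> topspace RP2" using assms(2) by (auto simp: topspace_RP2 RP2_points_eq)
  moreover have "(\<forall>x\<in>span {p}. f x = 0) \<longleftrightarrow> f p = 0"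
    using assms(1) by (auto simp: span_singleton intro: span_base)
  ultimately show ?thesis by (simp add: conic_of_def)
qed

lemma projective_conic_conic_of:
  "projective_conic C \<longleftrightarrow> (\<exists>M. transpose M = M \<and> M \<noteq> 0 \<and> C = conic_of (\<lambda>x. x \<bullet> (M *v x)))"
  by (simp add: projective_conic_def conic_of_def)

lemma conic_through_five:
  assumes "bracket a b c \<noteq> 0" "bracket a c d \<noteq> 0" "bracket a c e \<noteq> 0" "bracket b d e \<noteq> 0"
     "bracket a d e \<noteq> 0" "bracket b c d \<noteq> 0" "bracket b c e \<noteq> 0"
  shows "conic_through ((\<lambda>x. span {x}) ` {a, b, c, d, e}) = conic_of (conic_det a b c d e)"
    (is "conic_through ?S = ?C")
  unfolding conic_through_def
proof (rule the_equality)
  obtain M where M: "transpose M = M" "\<And>x. x \<bullet> (M *v x) = conic_det a b c d e x"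
    using conic_det_matrix[of a b c d e] by blast
  have hom: "conic_det a b c d e (k *\<^sub>R x) = k\<^sup>2 * conic_det a b c d e x" for k x
    unfolding M(2)[symmetric] by (rule quadratic_form_scaleR)
  have nz: "bracket a b c \<noteq> 0" "bracket a d c \<noteq> 0" "bracket a e c \<noteq> 0" "bracket b d e \<noteq> 0"
     "bracket a d e \<noteq> 0" "bracket b d c \<noteq> 0" "bracket c e b \<noteq> 0"
    using assms bracket_swap'[of a d c] bracket_swap'[of a e c] bracket_swap'[of b d c]
      bracket_rotate[of c e b] by simp_all
  have n0: "a \<noteq> 0" "b \<noteq> 0" "c \<noteq> 0" "d \<noteq> 0" "e \<noteq> 0"
    using nz by (auto simp: bracket_eq)
  have van: "conic_det a b c d e x = 0" if "x \<in> {a, b, c, d, e}" for x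
    using that by (auto simp: conic_det_def bracket_rotate algebra_simps)
  \<comment> \<open>The point \<open>b + c\<close> lies on the line through \<open>b\<close> and
    \<open>c\<close>, so one line pair of the pencil vanishes there while the other does not. Hence
    the form is not identically zero.\<close>
  have "bracket b d (b + c) = bracket b d c" "bracket c e (b + c) = bracket c e b" 
    "bracket b c (b + c) = 0"
    unfolding bracket_eq by (simp_all add: algebra_simps)
  then have nt: "conic_det a b c d e (b + c) \<noteq> 0"
    using nz bracket_rotate[of b c a] bracket_rotate[of d e a] by (simp add: conic_det_def)
  have "M \<noteq> 0" using nt M(2)[of "b + c"] by auto
  then have "projective_conic ?C" unfolding projective_conic_conic_of using M by auto
  moreover have "?S \<subseteq> ?C"
    using span_in_conic_of[of "conic_det a b c d e", OF hom] van n0 by auto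
  ultimately show "projective_conic ?C \<and> ?S \<subseteq> ?C" ..
  fix C assume C: "projective_conic C \<and> ?S \<subseteq> C"
  then obtain M' where M': "transpose M' = M'" "M' \<noteq> 0" "C = conic_of (\<lambda>x. x \<bullet> (M' *v x))"
    unfolding projective_conic_conic_of by blast
  have van': "x \<bullet> (M' *v x) = 0" if "x \<in> {a, b, c, d, e}" for x
  proof -
    have "span {x} \<in> C" "x \<noteq> 0" using C that n0 by auto
    then show ?thesis
      unfolding M'(3) using span_in_conic_of[of "\<lambda>x. x \<bullet> (M' *v x)" x] quadratic_form_scaleR by blast
  qed
  obtain G where G: "\<And>M::real^3^3. transpose M = M \<Longrightarrow> (\<And>x. x \<in> {a, b, c, d, e} \<Longrightarrow> x \<bullet> (M *v x) = 0)
       \<Longrightarrow> \<exists>k. \<forall>x. x \<bullet> (M *v x) = k * G x"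
    using conic_form_unique[OF nz(1-4)] by blast
  obtain k where k: "\<And>x. conic_det a b c d e x = k * G x" using G[OF M(1)] van M(2) by auto
  obtain k' where k': "\<And>x. x \<bullet> (M' *v x) = k' * G x" using G[OF M'(1)] van' by blast
  have "k \<noteq> 0" using nt k by auto
  moreover have "k' \<noteq> 0" using symmetric_matrix_eq_0[OF M'(1)] M'(2) k' by fastforce
  ultimately show "C = ?C" unfolding M'(3) conic_of_def k k' by simp
qed

text \<open>If \<open>p\<close> and \<open>q\<close> have the same sign under a quadratic form, then so has the whole segment
  from \<open>p\<close> to one of \<open>q\<close>, \<open>-q\<close>, namely the one for which the polar form has that sign.\<close>

lemma same_side_if_same_sign:
  fixes M :: "real^3^3"
  assumes M: "transpose M = M" and pos: "0 < (p \<bullet> (M *v p)) * (q \<bullet> (M *v q))"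
  shows "\<exists>S\<in>sides (conic_of (\<lambda>x. x \<bullet> (M *v x))). span {p} \<in> S \<and> span {q} \<in> S"
proof -
  let ?f = "\<lambda>x. x \<bullet> (M *v x)" and ?C = "conic_of (\<lambda>x. x \<bullet> (M *v x))"
  define r where "r = (if 0 \<le> ?f p * (p \<bullet> (M *v q)) then q else - q)"
  have "span {- q} = span {q}"
    using span_image_scale[of "{q}" "\<lambda>_. -1"] by simp
  then have r: "0 \<le> ?f p * (p \<bullet> (M *v r))" "0 < ?f p * ?f r" "span {r} = span {q}"
    using pos quadratic_form_scaleR[of "-1" q M] matrix_vector_mult_scaleR[of M "-1" q]
    by (auto simp: r_def split: if_splits)
  have seg: "?f x \<noteq> 0" if x: "x \<in> closed_segment p r" for x
  proof -
    obtain t where t: "x = (1 - t) *\<^sub>R p + t *\<^sub>R r" "0 \<le> t" "t \<le> 1"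
      using x by (auto simp: in_segment)
    have "?f x = (1-t)\<^sup>2 * ?f p + t\<^sup>2 * ?f r + 2 * ((1-t) * t * (p \<bullet> (M *v r)))"
      unfolding t(1) using quadratic_form_combination[OF M, of "1-t" p t r 0 0] by simp
    \<comment> \<open>Multiplication by \<open>?f p\<close> treats both signs of the form at once:
      every term on the right is nonnegative.\<close>
    then have "?f p * ?f x =
        (1-t)\<^sup>2 * (?f p)\<^sup>2 + t\<^sup>2 * (?f p * ?f r) + 2 * ((1-t) * t * (?f p * (p \<bullet> (M *v r))))"
      by algebra
    moreover have "0 \<le> (1-t) * t * (?f p * (p \<bullet> (M *v r)))" using t r by simp
    moreover have "0 < (1-t)\<^sup>2 * (?f p)\<^sup>2 + t\<^sup>2 * (?f p * ?f r)"
    proof (cases "t = 0")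
      case True
      then show ?thesis using pos by auto
    next
      case False
      then have "0 < t\<^sup>2 * (?f p * ?f r)" using r by simp
      then show ?thesis by (simp add: add_nonneg_pos)
    qed
    ultimately have "0 < ?f p * ?f x" by linarith
    then show ?thesis by auto
  qed
  then have n0: "0 \<notin> closed_segment p r" by fastforce
  let ?T = "(\<lambda>x. span {x}) ` closed_segment p r"
  have "connectedin RP2 ?T"
  proof (rule connectedin_continuous_map_image)
    show "continuous_map (top_of_set (UNIV - {0})) RP2 (\<lambda>x. span {x})"
      using quotient_map_RP2 by (rule quotient_imp_continuous_map)
    show "connectedin (top_of_set (UNIV - {0})) (closed_segment p r)"
      using n0 by (auto simp: connectedin_subtopology)
  qed
  moreover have "?T \<subseteq> topspace RP2 - ?C"
  proof -
    have "span {x} \<in> topspace RP2 - ?C" if "x \<in> closed_segment p r" for x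
    proof -
      have "x \<noteq> 0" using that n0 by auto
      then have "span {x} \<in> ?C \<longleftrightarrow> ?f x = 0"
        using span_in_conic_of[of ?f x] quadratic_form_scaleR by blast
      then show ?thesis using seg[OF that] \<open>x \<noteq> 0\<close> by (auto simp: topspace_RP2 RP2_points_eq)
    qed
    then show ?thesis by blast
  qed
  ultimately have conn: "connectedin (subtopology RP2 (topspace RP2 - ?C)) ?T"
    by (simp add: connectedin_subtopology)
  have "subtopology RP2 (topspace RP2 - ?C) \<noteq> trivial_topology"
  proof
    assume "subtopology RP2 (topspace RP2 - ?C) = trivial_topology"
    then have "?T \<subseteq> {}" using connectedin_subset_topspace[OF conn] by simp
    then show False by simp
  qed
  then obtain S where "S \<in> sides ?C" "?T \<subseteq> S"
    using exists_connected_component_of_superset[OF conn] unfolding sides_def by blast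
  then show ?thesis using r(3) by (intro bexI[of _ S]) auto
qed

section \<open>Convex polygons\<close>

definition homog :: "real^2 \<Rightarrow> real^3" where
  "homog p = vector [p $ 1, p $ 2, 1]"

text \<open>Twice the signed area of the triangle, so the sign of the bracket is its
  orientation.\<close>

lemma bracket_homog:
  "bracket (homog p) (homog q) (homog r) =
     (q$1 - p$1) * (r$2 - p$2) - (q$2 - p$2) * (r$1 - p$1)"
  by (simp add: bracket_eq homog_def algebra_simps)

lemma homog_nonzero: "homog p \<noteq> 0"
  by (auto simp: homog_def vec_eq_iff intro: exI[of _ 3])

lemma bracket_eq_0_imp_affine_hull:
  assumes "bracket (homog u) (homog v) (homog w) = 0" "u \<noteq> v"
  shows "w \<in> affine hull {u, v}"
proof -
  have eq: "(v$1 - u$1) * (w$2 - u$2) = (v$2 - u$2) * (w$1 - u$1)"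
    using assms(1) by (simp add: bracket_homog)
  have "\<exists>t. w = u + t *\<^sub>R (v - u)"
  proof (cases "v$1 = u$1")
    case True
    then have "v$2 \<noteq> u$2" using assms(2) by (auto simp: vec_eq_iff forall_2)
    moreover from this have "w$1 = u$1" using eq True by simp
    ultimately show ?thesis using True
      by (intro exI[of _ "(w$2 - u$2) / (v$2 - u$2)"]) (simp add: vec_eq_iff forall_2)
  next
    case False
    define t where "t = (w$1 - u$1) / (v$1 - u$1)"
    have "w$1 - u$1 = t * (v$1 - u$1)" using False by (simp add: t_def)
    moreover have "w$2 - u$2 = t * (v$2 - u$2)"
      using False eq by (simp add: t_def eq_divide_eq mult.commute)
    ultimately show ?thesis
      by (intro exI[of _ t]) (simp add: vec_eq_iff forall_2 diff_eq_eq add.commute)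
  qed
  then obtain t where "w = (1 - t) *\<^sub>R u + t *\<^sub>R v" by (auto simp: algebra_simps)
  then show ?thesis unfolding affine_hull_2 by (intro CollectI exI[of _ "1 - t"] exI[of _ t]) simp
qed

text \<open>If \<open>x\<close> and \<open>y\<close> were on opposite sides, the segment between
  them would cross the line of the edge inside \<open>P\<close>. That line meets \<open>P\<close>
  only in the edge, and a face containing an inner point of the segment contains \<open>x\<close>;
  but the only extreme points of \<open>P\<close> on the edge are its ends.\<close>

lemma extreme_points_same_side_of_edge:
  assumes P: "convex P" and edge: "closed_segment u v edge_of P" and uv: "u \<noteq> v"
    and x: "x extreme_point_of P" "x \<notin> {u, v}" and y: "y extreme_point_of P" "y \<notin> {u, v}"
  shows "0 < bracket (homog u) (homog v) (homog x) * bracket (homog u) (homog v) (homog y)"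
proof -
  let ?F = "closed_segment u v" and ?b = "\<lambda>w. bracket (homog u) (homog v) (homog w)"
  have F: "?F face_of P" using edge by (simp add: edge_of_def)
  have line: "w \<in> ?F" if "?b w = 0" "w \<in> P" for w
  proof -
    have "w \<in> affine hull ?F"
      using bracket_eq_0_imp_affine_hull[OF that(1) uv] hull_mono[of "{u, v}" ?F] by auto
    then show ?thesis using face_of_imp_eq_affine_Int[OF P F] that(2) by blast
  qed
  have ext: "w \<notin> ?F" if "w extreme_point_of P" "w \<notin> {u, v}" for w
    using that extreme_point_of_face[OF F, of w] extreme_point_of_segment[of w u v] by blast
  have xyP: "x \<in> P" "y \<in> P" using x y by (simp_all add: extreme_point_of_def)
  have nz: "?b x \<noteq> 0" "?b y \<noteq> 0" using ext x y line xyP by blast+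
  show ?thesis
  proof (rule ccontr)
    assume "\<not> ?thesis"
    then have opp: "?b x < 0 \<and> 0 < ?b y \<or> 0 < ?b x \<and> ?b y < 0"
      using nz by (simp add: zero_less_mult_iff) linarith
    \<comment> \<open>The parameter at which the bracket, affine along the segment,
      vanishes.\<close>
    define s where "s = ?b x / (?b x - ?b y)"
    have s: "0 < s" "s < 1" using opp by (auto simp: s_def divide_simps)
    define w where "w = (1 - s) *\<^sub>R x + s *\<^sub>R y"
    have "?b w = (1 - s) * ?b x + s * ?b y" by (simp add: bracket_homog w_def algebra_simps)
    also have "\<dots> = ?b x - s * (?b x - ?b y)" by (simp add: algebra_simps)
    also have "\<dots> = 0" using opp by (auto simp: s_def)
    finally have b: "?b w = 0" .
    have "w \<in> P" using P xyP s by (simp add: w_def convexD)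
    then have "w \<in> ?F" using line b by blast
    moreover have "x \<noteq> y" using opp by auto
    then have "w \<in> open_segment x y" using s by (auto simp: in_segment w_def)
    ultimately have "x \<in> ?F" using F xyP unfolding face_of_def by blast
    then show False using ext x by blast
  qed
qed

text \<open>Seen from \<open>h i\<close>, the other vertices lie in a half-plane and consecutive ones are in
  counterclockwise order (up to \<open>\<sigma>\<close>), and in a half-plane this order is transitive.\<close>

lemma convex_position_if_edges:
  assumes h: "\<And>m. h (m + n) = h m" and n: "3 \<le> n"
    and edge: "\<And>i k. i + 1 < k \<Longrightarrow> k < i + n \<Longrightarrow>
      0 < bracket (h i) (h (i+1)) (h (i+2)) * bracket (h i) (h (i+1)) (h k)"
  shows "convex_position (bracket (h 0) (h 1) (h 2)) n h"
proof -
  let ?e = "\<lambda>i. bracket (h i) (h (i+1)) (h (i+2))"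
  define \<sigma> where "\<sigma> = bracket (h 0) (h 1) (h 2)"
  have e: "0 < \<sigma> * ?e i" for i
  proof (induction i)
    case 0
    show ?case using edge[of 0 2] n by (simp add: \<sigma>_def numeral_2_eq_2)
  next
    case (Suc i)
    \<comment> \<open>The index \<open>i + n\<close> denotes the preceding vertex
      \<open>h i\<close>, so the second bracket is a rotation of \<open>?e i\<close>: consecutive
      corners turn the same way.\<close>
    have "0 < ?e (i+1) * bracket (h (i+1)) (h (i+1+1)) (h (i+n))"
      using edge[of "i+1" "i+n"] n by simp
    then have "0 < ?e i * ?e (i+1)" by (simp add: h bracket_rotate mult.commute)
    then have "0 < ?e i * \<sigma> \<Longrightarrow> 0 < \<sigma> * ?e (i+1)" by (auto simp: zero_less_mult_iff)
    then show ?case using Suc by (simp add: mult.commute)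
  qed
  have adj: "0 < \<sigma> * bracket (h i) (h (i+1)) (h k)" if "i + 1 < k" "k < i + n" for i k
    using e[of i] edge[OF that] by (auto simp: zero_less_mult_iff)
  have "0 < \<sigma> * bracket (h i) (h j) (h k)" if "i < j" "j < k" "k < i + n" for i j k
  proof (cases "j = i + 1")
    case True
    then show ?thesis using adj[of i k] that by simp
  next
    case False
    have last: "0 < \<sigma> * bracket (h i) (h l) (h (l+1))" if "i < l" "l + 1 < i + n" for l
      using adj[of l "i + n"] that by (simp add: h bracket_rotate)
    have "Suc j \<le> k" using that by simp
    then show ?thesis using that(3)
    proof (induction k rule: dec_induct)
      case base
      then show ?case using last[of j] that by simp
    next
      case (step k)
      let ?b = "\<lambda>a c. \<sigma> * bracket (h i) (h a) (h c)"
      \<comment> \<open>Pluecker relation seen from \<open>h i\<close>, with \<open>h (i+1)\<close>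
        as reference direction; every factor other than \<open>?b j (k+1)\<close> is already known
        to be positive.\<close>
      have "?b (i+1) k * ?b j (k+1) = ?b (i+1) j * ?b k (k+1) + ?b (i+1) (k+1) * ?b j k"
        using bracket_Pluecker[of "h i" "h (i+1)" "h j" "h k" "h (k+1)"] by algebra
      moreover have "0 < ?b (i+1) k" "0 < ?b (i+1) j" "0 < ?b (i+1) (k+1)" "0 < ?b k (k+1)" "0 < ?b j k"
        using adj[of i k] adj[of i j] adj[of i "k+1"] last[of k] step False that by auto
      ultimately have "0 < ?b (i+1) k * ?b j (k+1)" by (simp add: add_pos_pos)
      then have "0 < ?b j (k+1)" using \<open>0 < ?b (i+1) k\<close> by (rule zero_less_mult_pos)
      then show ?case by simp
    qed
  qed
  then show ?thesis using h by (simp add: convex_position_def \<sigma>_def)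
qed

lemma convex_ngon_periodic:
  assumes "convex_ngon n P V"
  shows "V (i + int n) = V i"
  using assms by (simp add: convex_ngon_def)

lemma convex_ngon_distinct:
  assumes V: "convex_ngon n P V" and ij: "i < j" "j < i + int n"
  shows "V i \<noteq> V j"
proof
  have per: "V (i + int k * int n) = V i" for i k
  proof (induction k)
    case (Suc k)
    then show ?case using convex_ngon_periodic[OF V, of "i + int k * int n"]
      by (simp add: algebra_simps)
  qed simp
  have mod: "V i = V ((i - 1) mod int n + 1)" for i
  proof -
    let ?q = "(i - 1) div int n"
    have i: "(i - 1) mod int n + 1 = i - ?q * int n"
      using div_mult_mod_eq[of "i - 1" "int n"] by linarith
    \<comment> \<open>The lemma \<open>per\<close> moves forward only, so the sign of the quotient
      decides from which side it is applied.\<close>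
    show ?thesis
    proof (cases "0 \<le> ?q")
      case True
      then show ?thesis unfolding i using per[of "i - ?q * int n" "nat ?q"] by simp
    next
      case False
      then show ?thesis unfolding i using per[of i "nat (- ?q)"] by simp
    qed
  qed
  assume "V i = V j"
  then have "V ((i - 1) mod int n + 1) = V ((j - 1) mod int n + 1)" using mod by metis
  moreover have n: "0 < int n" using ij by linarith
  have "l mod int n + 1 \<in> {1..int n}" for l
    using pos_mod_sign[OF n, of l] pos_mod_bound[OF n, of l] unfolding atLeastAtMost_iff by linarith
  moreover have "inj_on V {1..int n}" using V by (simp add: convex_ngon_def)
  ultimately have "(i - 1) mod int n + 1 = (j - 1) mod int n + 1" by (meson inj_onD)
  then have "int n dvd (j - 1) - (i - 1)" unfolding mod_eq_dvd_iff[symmetric] by linarith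
  then have "int n dvd j - i" by simp
  then show False using ij zdvd_not_zless[of "j - i" "int n"] by simp
qed

lemma convex_position_convex_ngon:
  assumes V: "convex_ngon n P V" and n: "3 \<le> n"
  shows "\<exists>\<sigma>. convex_position \<sigma> n (\<lambda>m. homog (V (int m)))"
proof -
  let ?h = "\<lambda>m. homog (V (int m))"
  have ext: "V i extreme_point_of P" for i
    using V by (auto simp: convex_ngon_def)
  have "convex P" using V by (simp add: convex_ngon_def)
  then have "0 < bracket (?h i) (?h (i+1)) (?h (i+2)) * bracket (?h i) (?h (i+1)) (?h k)"
    if "i + 1 < k" "k < i + n" for i k
    using that n V ext
      convex_ngon_distinct[OF V, of "int i" "int i + 1"] convex_ngon_distinct[OF V, of "int i" "int i + 2"]
      convex_ngon_distinct[OF V, of "int i + 1" "int i + 2"]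
      convex_ngon_distinct[OF V, of "int i" "int k"] convex_ngon_distinct[OF V, of "int i + 1" "int k"]
    by (intro extreme_points_same_side_of_edge[of P]) (auto simp: convex_ngon_def add.commute)
  then show ?thesis
    using convex_position_if_edges[of ?h n] convex_ngon_periodic[OF V] n by auto
qed

text \<open>The windows at \<open>m\<close> and \<open>m + 1\<close> share the quintuple that starts
  at \<open>m + 1\<close>; each adds one of its two outer neighbours.\<close>

lemma extremal_if_window_dets_not_same_sign:
  assumes cp: "convex_position \<sigma> n (\<lambda>m. homog (V (int m)))" and n: "6 \<le> n"
    and le: "window_det (\<lambda>m. homog (V (int m))) m * window_det (\<lambda>m. homog (V (int m))) (m+1) \<le> 0"
  shows "extremal V (int m + 1)"
proof -
  define h where "h m = homog (V (int m))" for m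
  note cp = cp[folded h_def] and le = le[folded h_def]
  let ?f = "conic_det (h (m+1)) (h (m+2)) (h (m+3)) (h (m+4)) (h (m+5))"
  obtain M where M: "transpose M = M" "\<And>x. x \<bullet> (M *v x) = ?f x"
    using conic_det_matrix by blast
  have hom: "?f (k *\<^sub>R x) = k\<^sup>2 * ?f x" for k x
    unfolding M(2)[symmetric] by (rule quadratic_form_scaleR)
  have nz: "bracket (h i) (h j) (h k) \<noteq> 0" if "i < j" "j < k" "k < i + 6" for i j k
    using convex_position_bracket[OF cp that(1,2)] that n by auto
  have "{int m + 1..int m + 1 + 4} = {int (m+1), int (m+2), int (m+3), int (m+4), int (m+5)}"
    by (auto simp: atLeastAtMost_iff)
  then have "(\<lambda>j. proj_point (V j)) ` {int m + 1..int m + 1 + 4} =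
      (\<lambda>x. span {x}) ` {h (m+1), h (m+2), h (m+3), h (m+4), h (m+5)}"
    by (simp only: proj_point_def homog_def[symmetric] image_insert image_empty h_def)
  also have "conic_through \<dots> = conic_of ?f"
    using nz[of "m+1" "m+2" "m+3"] nz[of "m+1" "m+3" "m+4"] nz[of "m+1" "m+3" "m+5"]
      nz[of "m+2" "m+4" "m+5"] nz[of "m+1" "m+4" "m+5"] nz[of "m+2" "m+3" "m+4"]
      nz[of "m+2" "m+3" "m+5"]
    by (intro conic_through_five) simp_all
  finally have C: "conic_through ((\<lambda>j. proj_point (V j)) ` {int m + 1..int m + 1 + 4}) = conic_of ?f" .
  have pq: "proj_point (V (int m + 1 - 1)) = span {h m}" "proj_point (V (int m + 1 + 5)) = span {h (m+6)}"
    by (simp_all add: proj_point_def homog_def[symmetric] h_def add.commute)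
  \<comment> \<open>The minus sign of the rotation turns the nonpositive product of determinants
    into a nonnegative product of values of the form.\<close>
  have "?f (h m) = - window_det h m"
    unfolding window_det_def by (rule conic_det_rotate)
  moreover have "?f (h (m+6)) = window_det h (m+1)" by (simp add: window_det_def numeral_eq_Suc)
  ultimately have ge: "0 \<le> ?f (h m) * ?f (h (m+6))" using le by simp
  have in_C: "span {h i} \<in> conic_of ?f \<longleftrightarrow> ?f (h i) = 0" for i
    by (rule span_in_conic_of[OF hom]) (simp add: h_def homog_nonzero)
  show ?thesis
  proof (cases "?f (h m) = 0 \<or> ?f (h (m+6)) = 0")
    case True
    then show ?thesis unfolding extremal_def Let_def C pq in_C by blast
  next
    case False
    then have "0 < ?f (h m) * ?f (h (m+6))" using ge by (simp add: less_le)
    then have "\<exists>S\<in>sides (conic_of ?f). span {h m} \<in> S \<and> span {h (m+6)} \<in> S"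
      using same_side_if_same_sign[OF M(1), of "h m" "h (m+6)"] unfolding M(2) by blast
    then show ?thesis unfolding extremal_def Let_def C pq by blast
  qed
qed

theorem theorem2p6:
  fixes n :: nat and P :: "(real^2) set" and V :: "int \<Rightarrow> real^2"
  assumes "n \<ge> 6"
    and "convex_ngon n P V"
  shows "card {i \<in> {1..int n}. extremal V i} \<ge> 6"
proof -
  let ?h = "\<lambda>m. homog (V (int m))"
  let ?S = "{m. m < n \<and> window_det ?h m * window_det ?h (m+1) \<le> 0}"
  obtain \<sigma> where cp: "convex_position \<sigma> n ?h"
    using convex_position_convex_ngon[OF assms(2)] assms(1) by auto
  have "finite {i \<in> {1..int n}. extremal V i}"
    by (rule finite_subset[of _ "{1..int n}"]) auto
  \<comment> \<open>The windows are numbered from \<open>0\<close> to \<open>n - 1\<close>, and the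
    quintuple of window \<open>m\<close> starts at \<open>m + 1\<close>, in the range from
    \<open>1\<close> to \<open>n\<close>.\<close>
  then have le: "card ((\<lambda>m. int m + 1) ` ?S) \<le> card {i \<in> {1..int n}. extremal V i}"
    using extremal_if_window_dets_not_same_sign[OF cp assms(1)] by (intro card_mono) auto
  have "6 \<le> card ?S" using assms(1) cp by (rule card_nonpos_products_ge_6)
  also have "\<dots> = card ((\<lambda>m. int m + 1) ` ?S)"
    by (rule card_image[symmetric]) (simp add: inj_on_def)
  finally show ?thesis using le by (rule order_trans)
qed

end
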